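(* Fix an integer $d\geq1$, an odd prime $\ell$, and real parameters $$0<\alpha<d,\qquad 0\leq\kappa<\frac{\alpha}{2}.$$ Along $N=\ell^k$ ($k\ge1$), there are sets $S_N\subseteq\mathbb Z_N^d$ with $$|S_N|\asymp N^\alpha,\qquad \operatorname{FR}(1_{S_N})\asymp N^{\frac{d}{2}-\kappa},$$ and scalar multiples $f_N$ of $1_{S_N}$ such that $$\|\widehat f_N\|_\infty=1,\qquad \sup_N\|\widehat f_N\|_{p_c}<\infty,\qquad p_c=\frac{2(d-2\kappa)}{\alpha-2\kappa}.$$ Thus the critical exponent $p_c$ is sharp for every admissible pair $(\alpha,\kappa)$ in the fixed dimension $d$: the implication "$\sup_N\|\widehat f_N\|_p<\infty\Rightarrow\|\widehat f_N\|_\infty\to0$" fails at $p=p_c$ for these $f_N$ supported on $S_N$.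
   Context: $\mathbb Z_N=\mathbb Z/N\mathbb Z$. For $f:\mathbb Z_N^d\to\mathbb C$ the unitary Fourier transform is $\widehat f(\xi)=N^{-d/2}\sum_{x\in\mathbb Z_N^d}f(x)e^{-2\pi i x\cdot\xi/N}$. All norms use counting measure: $\|f\|_r=(\sum_x|f(x)|^r)^{1/r}$, $\|f\|_\infty=\max_x|f(x)|$. $1_S$ is the indicator of $S$. For $f\ne0$, $\operatorname{FR}(f)=\|\widehat f\|_1/\|\widehat f\|_2$. $A\asymp B$ means $cB\le A\le CB$ with positive constants $c,C$ independent of the modulus $N$ (they may depend on the fixed data $d,\ell,\alpha,\kappa$). *)

theory Defs
  imports Complex_Main "HOL-Library.FuncSet" "HOL-Library.Indicator_Function"
    "HOL-Computational_Algebra.Primes"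
begin

(* Elements of (Z/NZ)^d are represented by their coordinates' least residues
   in {0,...,N-1}; outside the index set {0,...,d-1} they are undefined, so that
   each element has exactly one representative.  A function on (Z/NZ)^d is a
   function on all of nat => nat of which only the values on this set matter. *)
definition ZNd :: "nat \<Rightarrow> nat \<Rightarrow> (nat \<Rightarrow> nat) set" where
  "ZNd N d = {..<d} \<rightarrow>\<^sub>E {..<N}"

definition dot :: "nat \<Rightarrow> (nat \<Rightarrow> nat) \<Rightarrow> (nat \<Rightarrow> nat) \<Rightarrow> nat" where
  "dot d x \<xi> = (\<Sum>i<d. x i * \<xi> i)"

definition fourier :: "nat \<Rightarrow> nat \<Rightarrow> ((nat \<Rightarrow> nat) \<Rightarrow> complex) \<Rightarrow> (nat \<Rightarrow> nat) \<Rightarrow> complex" where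
  "fourier N d f \<xi> =
     complex_of_real (real N powr (- (real d / 2))) *
     (\<Sum>x\<in>ZNd N d. f x * exp (- (2 * complex_of_real pi * \<i> * of_nat (dot d x \<xi>) / of_nat N)))"

definition Lnorm :: "nat \<Rightarrow> nat \<Rightarrow> real \<Rightarrow> ((nat \<Rightarrow> nat) \<Rightarrow> complex) \<Rightarrow> real" where
  "Lnorm N d r f = (\<Sum>x\<in>ZNd N d. norm (f x) powr r) powr (1 / r)"

definition Lnorm_inf :: "nat \<Rightarrow> nat \<Rightarrow> ((nat \<Rightarrow> nat) \<Rightarrow> complex) \<Rightarrow> real" where
  "Lnorm_inf N d f = Max ((\<lambda>x. norm (f x)) ` ZNd N d)"

definition FR :: "nat \<Rightarrow> nat \<Rightarrow> ((nat \<Rightarrow> nat) \<Rightarrow> complex) \<Rightarrow> real" where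
  "FR N d f = Lnorm N d 1 (fourier N d f) / Lnorm N d 2 (fourier N d f)"

(* Two-sided comparability with constants uniform over the whole index set K;
   unlike bigtheta, it is not only an eventual statement. *)
definition comparable_on :: "'a set \<Rightarrow> ('a \<Rightarrow> real) \<Rightarrow> ('a \<Rightarrow> real) \<Rightarrow> bool" where
  "comparable_on K A B \<longleftrightarrow>
     (\<exists>c C. 0 < c \<and> 0 < C \<and> (\<forall>k\<in>K. c * B k \<le> A k \<and> A k \<le> C * B k))"

definition crit_exp :: "nat \<Rightarrow> real \<Rightarrow> real \<Rightarrow> real" where
  "crit_exp d \<alpha> \<kappa> = 2 * (real d - 2 * \<kappa>) / (\<alpha> - 2 * \<kappa>)"

end

(* Put N = Q r with r about N^(2 kappa / d), and let S be the preimage under reduction modulo Q of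
   a set T in (Z/QZ)^d with |T| = n about N^(alpha - 2 kappa).  The transform of 1_S is the
   transform of T placed on a lattice of M = Q^d frequencies.  For a random T an exponential moment
   bound shows that the average of |sum_{t in T} e(-t.eta/Q)|^p is O(n^(p/2)) for each eta <> 0,
   without logarithmic loss, so some T satisfies
     sum_eta |sum_t e(-t.eta/Q)|^p <= n^p + O(M n^(p/2)).
   The exponent p = p_c is the one for which n^(p/2) is comparable with M, so that the peak at 0 and
   the bulk contribute equally.  Normalised by n, this bounds the p-norm; together with Plancherel,
   sum_eta |.|^2 = M n, it also forces the 1-norm to be at least of order M sqrt n, whence FR is of
   order sqrt M, about N^(d/2 - kappa). *)
theory Submission
  imports Defs "HOL-Analysis.Convex"
begin

section \<open>Exponential moments of sums of independent selections\<close>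

text \<open>For negative \<open>x = -y\<close>, inverting the quadratic Taylor lower bound for
  \<open>exp y\<close> suffices, because (1 - y + y^2)(1 + y + y^2/2) is at least 1.\<close>

lemma exp_le_quadratic:
  fixes x :: real
  assumes "\<bar>x\<bar> \<le> 1"
  shows "exp x \<le> 1 + x + x\<^sup>2"
proof (cases "x \<ge> 0")
  case True
  then show ?thesis using exp_bound[of x] assms by simp
next
  case False
  define y where "y = -x"
  have y: "0 \<le> y" "y \<le> 1" using False assms by (auto simp: y_def)
  have pos: "0 < 1 - y + y\<^sup>2" using y by (cases "y = 1") (auto intro: add_pos_nonneg)
  have "(1 - y + y\<^sup>2) * (1 + y + y\<^sup>2 / 2) = 1 + y\<^sup>2 / 2 + y ^ 3 / 2 + y ^ 4 / 2"
    by (simp add: field_simps power2_eq_square power3_eq_cube power4_eq_xxxx)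
  then have "1 \<le> (1 - y + y\<^sup>2) * (1 + y + y\<^sup>2 / 2)" using y by simp
  also have "\<dots> \<le> (1 - y + y\<^sup>2) * exp y"
    using pos exp_lower_Taylor_quadratic[OF y(1)] by (intro mult_left_mono) auto
  finally have "exp (-y) \<le> 1 - y + y\<^sup>2" by (simp add: exp_minus field_simps)
  then show ?thesis by (simp add: y_def)
qed

text \<open>The zero mean removes the linear term of \<open>exp_le_quadratic\<close>, leaving only a
  second-order loss. With \<open>\<delta>\<close> of size 1/sqrt n, a product of n such factors
  stays bounded.\<close>

lemma sum_exp_block_le:
  fixes u :: "'b \<Rightarrow> real" and \<delta> :: real
  assumes "(\<Sum>b\<in>B. u b) = 0" and "\<And>b. b \<in> B \<Longrightarrow> \<bar>u b\<bar> \<le> \<delta>" and "\<delta> \<le> 1"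
  shows "(\<Sum>b\<in>B. exp (u b)) \<le> card B * (1 + \<delta>\<^sup>2)"
proof -
  have "(\<Sum>b\<in>B. exp (u b)) \<le> (\<Sum>b\<in>B. (1 + \<delta>\<^sup>2) + u b)"
  proof (rule sum_mono)
    fix b assume b: "b \<in> B"
    have "(u b)\<^sup>2 \<le> \<delta>\<^sup>2" using assms(2)[OF b] by (simp add: abs_le_square_iff[symmetric])
    moreover have "exp (u b) \<le> 1 + u b + (u b)\<^sup>2"
      using assms(2)[OF b] assms(3) by (intro exp_le_quadratic) simp
    ultimately show "exp (u b) \<le> (1 + \<delta>\<^sup>2) + u b" by simp
  qed
  also have "\<dots> = card B * (1 + \<delta>\<^sup>2)" using assms(1) by (simp add: sum.distrib)
  finally show ?thesis .
qed

text \<open>A Hoeffding-type bound: for a uniformly random selection \<open>g\<close> the values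
  \<open>g j\<close> are independent, so the sum of exponentials over all \<open>g\<close>
  factorises over \<open>J\<close>. At the scale sqrt n the average of the exponential is at most e,
  which is why no logarithm appears later.\<close>

lemma sum_exp_selection_le:
  fixes y :: "'j \<Rightarrow> 'b \<Rightarrow> real"
  assumes "finite J" "J \<noteq> {}" "finite B" "B \<noteq> {}"
    and bound: "\<And>j b. \<lbrakk>j \<in> J; b \<in> B\<rbrakk> \<Longrightarrow> \<bar>y j b\<bar> \<le> 1"
    and mean: "(\<Sum>j\<in>J. \<Sum>b\<in>B. y j b) = 0"
  shows "(\<Sum>g\<in>J \<rightarrow>\<^sub>E B. exp ((\<Sum>j\<in>J. y j (g j)) / (2 * sqrt (card J))))
           \<le> exp 1 * real (card B) ^ card J"
proof -
  define n where "n = card J"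
  define L where "L = 1 / (2 * sqrt n)"
  \<comment> \<open>Only the total mean over all blocks is known to vanish. Each block is therefore
    centred by its own mean, and the centring terms cancel in the sum over \<open>J\<close>.\<close>
  define m where "m j = (\<Sum>b\<in>B. y j b) / card B" for j
  have n: "n \<ge> 1" using assms by (simp add: n_def Suc_leI card_gt_0_iff)
  have cB: "card B > 0" using assms by (simp add: card_gt_0_iff)
  have m0: "(\<Sum>j\<in>J. m j) = 0" using mean by (simp add: m_def flip: sum_divide_distrib)
  have mb: "\<bar>m j\<bar> \<le> 1" if "j \<in> J" for j
  proof -
    have "\<bar>\<Sum>b\<in>B. y j b\<bar> \<le> (\<Sum>b\<in>B. 1)"
      using bound[OF that] by (intro order_trans[OF sum_abs] sum_mono) auto
    then show ?thesis using cB by (simp add: m_def field_simps)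
  qed
  have block: "(\<Sum>b\<in>B. exp (L * (y j b - m j))) \<le> card B * (1 + 1 / n)" if j: "j \<in> J" for j
  proof -
    have "(\<Sum>b\<in>B. exp (L * (y j b - m j))) \<le> card B * (1 + (1 / sqrt n)\<^sup>2)"
    proof (rule sum_exp_block_le)
      show "(\<Sum>b\<in>B. L * (y j b - m j)) = 0"
        using cB by (simp add: m_def sum_subtractf flip: sum_distrib_left)
      show "\<bar>L * (y j b - m j)\<bar> \<le> 1 / sqrt n" if "b \<in> B" for b
      proof -
        \<comment> \<open>Centring may double the bound 1; this is the source of the 2 in
          \<open>2 * sqrt n\<close>.\<close>
        have "\<bar>y j b - m j\<bar> \<le> 2" using bound[OF j that] mb[OF j] by linarith
        then have "L * \<bar>y j b - m j\<bar> \<le> L * 2" by (intro mult_left_mono) (simp_all add: L_def)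
        then show ?thesis by (simp add: L_def abs_mult)
      qed
      show "1 / sqrt n \<le> 1" using n by simp
    qed
    then show ?thesis using n by (simp add: power_divide)
  qed
  have "(\<Sum>g\<in>J \<rightarrow>\<^sub>E B. exp ((\<Sum>j\<in>J. y j (g j)) / (2 * sqrt (card J))))
      = (\<Sum>g\<in>J \<rightarrow>\<^sub>E B. \<Prod>j\<in>J. exp (L * (y j (g j) - m j)))"
  proof (rule sum.cong)
    fix g
    have "(\<Sum>j\<in>J. y j (g j)) / (2 * sqrt (card J)) = (\<Sum>j\<in>J. L * (y j (g j) - m j))"
      using m0 by (simp add: sum_subtractf L_def n_def flip: sum_distrib_left sum_divide_distrib)
    then show "exp ((\<Sum>j\<in>J. y j (g j)) / (2 * sqrt (card J))) = (\<Prod>j\<in>J. exp (L * (y j (g j) - m j)))"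
      using \<open>finite J\<close> by (simp add: exp_sum)
  qed simp
  also have "\<dots> = (\<Prod>j\<in>J. \<Sum>b\<in>B. exp (L * (y j b - m j)))"
    using assms by (simp add: prod_sum_PiE)
  also have "\<dots> \<le> (\<Prod>j\<in>J. card B * (1 + 1 / n))"
    using block by (intro prod_mono) (auto intro!: sum_nonneg)
  also have "\<dots> = real (card B) ^ n * (1 + 1 / n) ^ n" by (simp add: n_def power_mult_distrib)
  also have "\<dots> \<le> real (card B) ^ n * exp 1"
    using exp_ge_one_plus_x_over_n_power_n[of n 1] n by (intro mult_left_mono) auto
  finally show ?thesis by (simp add: n_def mult.commute)
qed

text \<open>Take the \<open>p\<close>-th power of x <= exp x at x = t/p. This trades a
  \<open>p\<close>-th moment for an exponential moment at the cost of a constant depending on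
  \<open>p\<close> alone.\<close>

lemma powr_le_exp:
  fixes t p :: real
  assumes "0 \<le> t" "0 < p"
  shows "t powr p \<le> p powr p * exp t"
proof -
  have "t / p \<le> exp (t / p)" using exp_ge_add_one_self[of "t/p"] by linarith
  then have "(t / p) powr p \<le> exp (t / p) powr p" using assms by (intro powr_mono2) auto
  also have "\<dots> = exp t" using assms by (simp add: powr_def)
  finally show ?thesis using assms by (simp add: powr_divide field_simps)
qed

text \<open>The norm is at most twice the larger of the absolute real and imaginary parts, so one of
  the four terms already dominates. This reduces the complex case to four real ones.\<close>

lemma exp_norm_le:
  fixes z :: complex
  assumes "0 \<le> c"
  shows "exp (c * norm z) \<le> exp (2 * c * Re z) + exp (2 * c * - Re z) + exp (2 * c * Im z) + exp (2 * c * - Im z)"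
proof -
  define M where "M = max \<bar>Re z\<bar> \<bar>Im z\<bar>"
  have "norm z \<le> 2 * M" using cmod_le[of z] by (simp add: M_def)
  then have "exp (c * norm z) \<le> exp (c * (2 * M))" using assms by (simp add: mult_left_mono)
  then have "exp (c * norm z) \<le> exp (2 * c * M)" by (simp add: mult.assoc mult.left_commute)
  moreover have "M = Re z \<or> M = - Re z \<or> M = Im z \<or> M = - Im z" by (auto simp: M_def max_def abs_if)
  ultimately show ?thesis
    by (smt (verit) exp_gt_zero)
qed

lemma sum_norm_powr_selection_le:
  fixes z :: "'j \<Rightarrow> 'b \<Rightarrow> complex" and p :: real
  assumes fin: "finite J" "J \<noteq> {}" "finite B" "B \<noteq> {}" and p: "0 < p"
    and bound: "\<And>j b. \<lbrakk>j \<in> J; b \<in> B\<rbrakk> \<Longrightarrow> norm (z j b) \<le> 1"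
    and mean: "(\<Sum>j\<in>J. \<Sum>b\<in>B. z j b) = 0"
  shows "(\<Sum>g\<in>J \<rightarrow>\<^sub>E B. norm (\<Sum>j\<in>J. z j (g j)) powr p)
           \<le> 4 * exp 1 * (4 * p) powr p * real (card J) powr (p / 2) * real (card B) ^ card J"
proof -
  define n where "n = card J"
  have n: "n > 0" using fin by (simp add: n_def card_gt_0_iff)
  \<comment> \<open>Chosen so that \<open>2 * c\<close>, the coefficient left after passing to real
    and imaginary parts, is exactly the scale of the real exponential bound.\<close>
  define c where "c = 1 / (4 * sqrt n)"
  have c: "c > 0" "2 * c = 1 / (2 * sqrt n)" using n by (simp_all add: c_def)
  let ?X = "\<lambda>g. \<Sum>j\<in>J. z j (g j)"
  define K where "K = (4 * p) powr p * real n powr (p / 2)"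
  \<comment> \<open>Applying \<open>powr_le_exp\<close> to c times the norm costs this factor; the
    power of n to p/2 enters here.\<close>
  have K: "(p / c) powr p = K"
  proof -
    have "p / c = (4 * p) * sqrt n" using n by (simp add: c_def)
    then show ?thesis using p n
      by (simp add: K_def powr_mult powr_powr flip: powr_half_sqrt)
  qed
  have E: "(\<Sum>g\<in>J \<rightarrow>\<^sub>E B. exp (2 * c * (\<Sum>j\<in>J. y j (g j)))) \<le> exp 1 * real (card B) ^ n"
    if "\<And>j b. \<lbrakk>j \<in> J; b \<in> B\<rbrakk> \<Longrightarrow> \<bar>y j b\<bar> \<le> 1" "(\<Sum>j\<in>J. \<Sum>b\<in>B. y j b) = 0" for y
    using sum_exp_selection_le[OF fin that] by (simp add: c n_def)
  have Re0: "(\<Sum>j\<in>J. \<Sum>b\<in>B. Re (z j b)) = 0" and Im0: "(\<Sum>j\<in>J. \<Sum>b\<in>B. Im (z j b)) = 0"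
    using mean by (simp_all flip: Re_sum Im_sum)
  have Reb: "\<bar>Re (z j b)\<bar> \<le> 1" and Imb: "\<bar>Im (z j b)\<bar> \<le> 1" if "j \<in> J" "b \<in> B" for j b
    using bound[OF that] abs_Re_le_cmod[of "z j b"] abs_Im_le_cmod[of "z j b"] by linarith+
  have "(\<Sum>g\<in>J \<rightarrow>\<^sub>E B. norm (?X g) powr p) \<le> (\<Sum>g\<in>J \<rightarrow>\<^sub>E B. K * exp (c * norm (?X g)))"
  proof (rule sum_mono)
    fix g
    have "(c * norm (?X g)) powr p \<le> p powr p * exp (c * norm (?X g))"
      using c p by (intro powr_le_exp) auto
    then show "norm (?X g) powr p \<le> K * exp (c * norm (?X g))"
      using c p by (simp add: powr_mult powr_divide field_simps flip: K)
  qed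
  also have "\<dots> \<le> (\<Sum>g\<in>J \<rightarrow>\<^sub>E B. K * (exp (2 * c * Re (?X g)) + exp (2 * c * - Re (?X g))
                        + exp (2 * c * Im (?X g)) + exp (2 * c * - Im (?X g))))"
    using c by (intro sum_mono mult_left_mono exp_norm_le) (auto simp: K_def)
  also have "\<dots> = K * ((\<Sum>g\<in>J \<rightarrow>\<^sub>E B. exp (2 * c * (\<Sum>j\<in>J. Re (z j (g j)))))
     + (\<Sum>g\<in>J \<rightarrow>\<^sub>E B. exp (2 * c * (\<Sum>j\<in>J. - Re (z j (g j)))))
     + (\<Sum>g\<in>J \<rightarrow>\<^sub>E B. exp (2 * c * (\<Sum>j\<in>J. Im (z j (g j)))))
     + (\<Sum>g\<in>J \<rightarrow>\<^sub>E B. exp (2 * c * (\<Sum>j\<in>J. - Im (z j (g j))))))"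
    by (simp only: sum.distrib sum_negf Re_sum Im_sum flip: sum_distrib_left)
  also have "\<dots> \<le> K * (exp 1 * real (card B) ^ n + exp 1 * real (card B) ^ n
     + exp 1 * real (card B) ^ n + exp 1 * real (card B) ^ n)"
    using Re0 Im0 Reb Imb
    by (intro mult_left_mono add_mono E) (auto simp: K_def sum_negf)
  also have "\<dots> = 4 * exp 1 * (4 * p) powr p * real (card J) powr (p / 2) * real (card B) ^ card J"
    by (simp add: K_def n_def)
  finally show ?thesis .
qed

section \<open>Characters, orthogonality and Plancherel\<close>

lemma cis_sum: "cis (\<Sum>i\<in>A. f i) = (\<Prod>i\<in>A. cis (f i))"
  by (induction A rule: infinite_finite_induct) (simp_all add: cis_mult[symmetric])

text \<open>A geometric series whose ratio \<open>w\<close> is an N-th root of unity; the ratio is 1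
  exactly when N divides \<open>m\<close>.\<close>

lemma sum_cis_residues:
  assumes "0 < N"
  shows "(\<Sum>a<N. cis (-(2 * pi * (real_of_int m * real a) / real N)))
       = (if int N dvd m then of_nat N else 0)"
proof -
  define w where "w = cis (-(2 * pi * m / N))"
  have pow: "cis (-(2 * pi * (real_of_int m * real a) / real N)) = w ^ a" for a
  proof -
    have "-(2 * pi * (real_of_int m * real a) / real N) = real a * (-(2 * pi * m / N))" by simp
    then show ?thesis by (simp only: w_def DeMoivre)
  qed
  have wN: "w ^ N = 1"
  proof -
    have "w ^ N = cis (2 * pi * of_int (- m))" using assms by (simp add: w_def DeMoivre)
    also have "\<dots> = 1" by (rule cis_multiple_2pi) simp
    finally show ?thesis .
  qed
  show ?thesis
  proof (cases "w = 1")
    case True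
    then have "cos (-(2 * pi * m / N)) = 1" by (simp add: w_def complex_eq_iff)
    then obtain t where t: "-(2 * pi * m / N) = real_of_int t * 2 * pi"
      unfolding cos_one_2pi_int by auto
    then have "pi * real_of_int m = pi * (real_of_int (- t) * real N)"
      using assms by (simp add: field_simps)
    then have "real_of_int m = real_of_int (- t * int N)"
      by (subst (asm) mult_left_cancel[OF pi_neq_zero]) simp
    then have "m = - t * int N" by (simp only: of_int_eq_iff)
    then have "int N dvd m" by simp
    then show ?thesis using True by (simp add: pow)
  next
    case False
    have "\<not> int N dvd m"
    proof
      assume "int N dvd m"
      then obtain t where "m = int N * t" by auto
      then have "w = cis (2 * pi * of_int (- t))" using assms by (simp add: w_def mult.assoc)
      also have "\<dots> = 1" by (rule cis_multiple_2pi) simp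
      finally show False using False by simp
    qed
    then show ?thesis using False wN by (simp add: pow sum_gp_strict)
  qed
qed

text \<open>The character splits over coordinates, giving a product of one-dimensional sums. Integer
  entries in \<open>v\<close> allow differences of points, as Plancherel requires.\<close>

lemma sum_cis_ZNd:
  fixes v :: "nat \<Rightarrow> int"
  assumes "0 < N"
  shows "(\<Sum>\<xi>\<in>ZNd N d. cis (-(2 * pi * (\<Sum>i<d. real_of_int (v i) * real (\<xi> i)) / real N)))
       = (if \<forall>i<d. int N dvd v i then of_nat N ^ d else 0)"
proof -
  have "(\<Sum>\<xi>\<in>ZNd N d. cis (-(2 * pi * (\<Sum>i<d. real_of_int (v i) * real (\<xi> i)) / real N)))
      = (\<Sum>\<xi>\<in>ZNd N d. \<Prod>i<d. cis (-(2 * pi * (real_of_int (v i) * real (\<xi> i)) / real N)))"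
    by (simp add: sum_distrib_left sum_divide_distrib flip: cis_sum sum_negf)
  also have "\<dots> = (\<Prod>i<d. \<Sum>a<N. cis (-(2 * pi * (real_of_int (v i) * real a) / real N)))"
    by (simp add: ZNd_def prod_sum_PiE)
  also have "\<dots> = (if \<forall>i<d. int N dvd v i then of_nat N ^ d else 0)"
    using assms by (auto simp: sum_cis_residues intro!: prod_zero)
  finally show ?thesis .
qed

text \<open>The kernel of the transform without the unitary factor. Working with unnormalised sums
  keeps powers of N out of the counting arguments.\<close>

definition chi :: "nat \<Rightarrow> nat \<Rightarrow> (nat \<Rightarrow> nat) \<Rightarrow> (nat \<Rightarrow> nat) \<Rightarrow> complex" where
  "chi N d x \<xi> = cis (-(2 * pi * real (dot d x \<xi>) / real N))"

lemma norm_chi [simp]: "norm (chi N d x \<xi>) = 1"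
  by (simp add: chi_def)

lemma finite_ZNd [simp]: "finite (ZNd N d)"
  by (simp add: ZNd_def finite_PiE)

lemma card_ZNd [simp]: "card (ZNd N d) = N ^ d"
  by (simp add: ZNd_def card_PiE)

lemma fourier_eq_chi:
  "fourier N d f \<xi> = of_real (real N powr (- (real d / 2))) * (\<Sum>x\<in>ZNd N d. f x * chi N d x \<xi>)"
  by (simp add: fourier_def chi_def cis_conv_exp mult_ac)

lemma sum_chi:
  assumes "0 < N"
  shows "(\<Sum>x\<in>ZNd N d. chi N d x \<xi>) = (if \<forall>i<d. N dvd \<xi> i then of_nat N ^ d else 0)"
  using sum_cis_ZNd[OF assms, of "\<lambda>i. int (\<xi> i)" d]
  by (simp add: chi_def dot_def mult.commute)

lemma ZNd_eqI:
  assumes "x \<in> ZNd N d" "y \<in> ZNd M d" "\<And>i. i < d \<Longrightarrow> x i = y i"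
  shows "x = y"
  using assms unfolding ZNd_def by (intro PiE_ext[of x "{..<d}"]) auto

lemma ZNd_less: "x \<in> ZNd N d \<Longrightarrow> i < d \<Longrightarrow> x i < N"
  by (auto simp: ZNd_def)

lemma restrict_in_ZNd [simp]: "(\<lambda>i\<in>{..<d}. f i) \<in> ZNd N d \<longleftrightarrow> (\<forall>i<d. f i < N)"
  by (auto simp: ZNd_def PiE_iff)

text \<open>Expand the square into pairs of points and sum over frequencies first. Off-diagonal
  pairs vanish, since least residues congruent modulo N in every coordinate are equal.\<close>

lemma plancherel:
  assumes N: "0 < N" and T: "T \<subseteq> ZNd N d"
  shows "(\<Sum>\<eta>\<in>ZNd N d. (norm (\<Sum>t\<in>T. chi N d t \<eta>))\<^sup>2) = real N ^ d * real (card T)"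
proof -
  have fin: "finite T" using T finite_subset finite_ZNd by blast
  have ortho: "(\<Sum>\<eta>\<in>ZNd N d. chi N d t \<eta> * cnj (chi N d t' \<eta>)) = (if t = t' then of_nat N ^ d else 0)"
    if t: "t \<in> T" "t' \<in> T" for t t'
  proof -
    have "(\<Sum>\<eta>\<in>ZNd N d. chi N d t \<eta> * cnj (chi N d t' \<eta>))
        = (\<Sum>\<eta>\<in>ZNd N d. cis (-(2 * pi * (\<Sum>i<d. real_of_int (int (t i) - int (t' i)) * real (\<eta> i)) / real N)))"
    proof (rule sum.cong)
      fix \<eta>
      have "-(2 * pi * (\<Sum>i<d. real_of_int (int (t i) - int (t' i)) * real (\<eta> i)) / real N)
          = -(2 * pi * real (dot d t \<eta>) / real N) + 2 * pi * real (dot d t' \<eta>) / real N"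
        by (simp add: dot_def left_diff_distrib sum_subtractf right_diff_distrib diff_divide_distrib)
      then show "chi N d t \<eta> * cnj (chi N d t' \<eta>)
          = cis (-(2 * pi * (\<Sum>i<d. real_of_int (int (t i) - int (t' i)) * real (\<eta> i)) / real N))"
        by (simp only: chi_def cis_cnj cis_mult minus_minus)
    qed simp
    also have "\<dots> = (if \<forall>i<d. int N dvd int (t i) - int (t' i) then of_nat N ^ d else 0)"
      by (rule sum_cis_ZNd[OF N])
    also have "(\<forall>i<d. int N dvd int (t i) - int (t' i)) \<longleftrightarrow> t = t'"
    proof
      assume D: "\<forall>i<d. int N dvd int (t i) - int (t' i)"
      show "t = t'"
      proof (rule ZNd_eqI)
        show tt: "t \<in> ZNd N d" "t' \<in> ZNd N d" using t T by auto
        fix i assume i: "i < d"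
        have "int (t i) mod int N = int (t' i) mod int N" using D i by (simp add: mod_eq_dvd_iff)
        then show "t i = t' i" using ZNd_less[OF tt(1) i] ZNd_less[OF tt(2) i] by simp
      qed
    qed simp
    finally show ?thesis .
  qed
  have "complex_of_real (\<Sum>\<eta>\<in>ZNd N d. (norm (\<Sum>t\<in>T. chi N d t \<eta>))\<^sup>2)
      = (\<Sum>\<eta>\<in>ZNd N d. \<Sum>t\<in>T. \<Sum>t'\<in>T. chi N d t \<eta> * cnj (chi N d t' \<eta>))"
    by (simp only: of_real_sum complex_norm_square cnj_sum sum_product)
  also have "\<dots> = (\<Sum>t\<in>T. \<Sum>\<eta>\<in>ZNd N d. \<Sum>t'\<in>T. chi N d t \<eta> * cnj (chi N d t' \<eta>))"
    by (rule sum.swap)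
  also have "\<dots> = (\<Sum>t\<in>T. \<Sum>t'\<in>T. \<Sum>\<eta>\<in>ZNd N d. chi N d t \<eta> * cnj (chi N d t' \<eta>))"
    by (intro sum.cong refl sum.swap)
  also have "\<dots> = (\<Sum>t\<in>T. \<Sum>t'\<in>T. if t = t' then of_nat N ^ d else 0)"
    by (intro sum.cong refl) (simp add: ortho)
  also have "\<dots> = complex_of_real (real N ^ d * real (card T))"
    using fin by simp
  finally show ?thesis by (simp only: of_real_eq_iff)
qed

section \<open>Preimages under reduction modulo q and their transforms\<close>

text \<open>In each coordinate \<open>t\<close> is the low digit and \<open>h\<close> the high digit
  in base \<open>q\<close>, so for \<open>t\<close> in \<open>ZNd q d\<close> the reduction modulo
  \<open>q\<close> recovers \<open>t\<close>.\<close>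

definition mix :: "nat \<Rightarrow> nat \<Rightarrow> (nat \<Rightarrow> nat) \<Rightarrow> (nat \<Rightarrow> nat) \<Rightarrow> nat \<Rightarrow> nat" where
  "mix d q t h = (\<lambda>i\<in>{..<d}. t i + q * h i)"

text \<open>Division with remainder by \<open>q\<close> is the inverse. The bijection serves twice:
  to describe preimages, and to split the modulus of \<open>T\<close> into residue classes for the
  random selection.\<close>

lemma bij_betw_mix:
  assumes q: "0 < q"
  shows "bij_betw (\<lambda>(t, h). mix d q t h) (ZNd q d \<times> ZNd r d) (ZNd (q * r) d)"
proof (rule bij_betw_byWitness[where f' = "\<lambda>x. (\<lambda>i\<in>{..<d}. x i mod q, \<lambda>i\<in>{..<d}. x i div q)"])
  show "\<forall>a\<in>ZNd q d \<times> ZNd r d. (\<lambda>i\<in>{..<d}. (case a of (t, h) \<Rightarrow> mix d q t h) i mod q,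
            \<lambda>i\<in>{..<d}. (case a of (t, h) \<Rightarrow> mix d q t h) i div q) = a"
  proof
    fix a assume "a \<in> ZNd q d \<times> ZNd r d"
    then obtain t h where a: "a = (t, h)" and th: "t \<in> ZNd q d" "h \<in> ZNd r d" by auto
    have "(\<lambda>i\<in>{..<d}. mix d q t h i mod q) = t"
      using th q by (intro ZNd_eqI[of _ q d _ q]) (auto simp: mix_def ZNd_less)
    moreover have "(t i + q * h i) div q = h i" if "i < d" for i
      using th q that by (simp add: ZNd_less)
    then have "(\<lambda>i\<in>{..<d}. mix d q t h i div q) = h"
      using th by (intro ZNd_eqI[of _ r d _ r]) (auto simp: mix_def ZNd_less)
    ultimately show "(\<lambda>i\<in>{..<d}. (case a of (t, h) \<Rightarrow> mix d q t h) i mod q,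
            \<lambda>i\<in>{..<d}. (case a of (t, h) \<Rightarrow> mix d q t h) i div q) = a"
      by (simp add: a)
  qed
  show "\<forall>x\<in>ZNd (q * r) d. (case (\<lambda>i\<in>{..<d}. x i mod q, \<lambda>i\<in>{..<d}. x i div q) of (t, h) \<Rightarrow> mix d q t h) = x"
    using q by (auto simp: mix_def ZNd_def fun_eq_iff PiE_iff extensional_def)
  show "(\<lambda>(t, h). mix d q t h) ` (ZNd q d \<times> ZNd r d) \<subseteq> ZNd (q * r) d"
  proof clarify
    fix t h assume th: "t \<in> ZNd q d" "h \<in> ZNd r d"
    have "t i + q * h i < q * r" if "i < d" for i
    proof -
      have "t i < q" "Suc (h i) \<le> r" using th that by (auto simp: ZNd_less Suc_le_eq)
      then have "t i + q * h i < q * Suc (h i)" "q * Suc (h i) \<le> q * r"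
        by (simp, intro mult_le_mono) auto
      then show ?thesis by linarith
    qed
    then show "mix d q t h \<in> ZNd (q * r) d" by (simp add: mix_def)
  qed
  show "(\<lambda>x. (\<lambda>i\<in>{..<d}. x i mod q, \<lambda>i\<in>{..<d}. x i div q)) ` ZNd (q * r) d \<subseteq> ZNd q d \<times> ZNd r d"
    using q by (auto simp: ZNd_less less_mult_imp_div_less mult.commute)
qed

lemma dot_mix: "dot d (mix d q t h) \<xi> = dot d t \<xi> + q * dot d h \<xi>"
  by (simp add: dot_def mix_def distrib_right sum.distrib sum_distrib_left mult.assoc)

lemma chi_mix:
  assumes "0 < q"
  shows "chi (q * r) d (mix d q t h) \<xi> = chi (q * r) d t \<xi> * chi r d h \<xi>"
  using assms by (simp add: chi_def dot_mix cis_mult field_simps add_divide_distrib)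

text \<open>The preimage of \<open>T\<close> under reduction modulo \<open>q\<close>.\<close>
definition coset_union :: "nat \<Rightarrow> nat \<Rightarrow> nat \<Rightarrow> (nat \<Rightarrow> nat) set \<Rightarrow> (nat \<Rightarrow> nat) set" where
  "coset_union d q r T = (\<lambda>(t, h). mix d q t h) ` (T \<times> ZNd r d)"

lemma coset_union_subset: "0 < q \<Longrightarrow> T \<subseteq> ZNd q d \<Longrightarrow> coset_union d q r T \<subseteq> ZNd (q * r) d"
  using bij_betw_mix[of q d r] by (fastforce simp: coset_union_def bij_betw_def)

lemma inj_on_mix: "0 < q \<Longrightarrow> T \<subseteq> ZNd q d \<Longrightarrow> inj_on (\<lambda>(t, h). mix d q t h) (T \<times> ZNd r d)"
  using bij_betw_mix[of q d r] by (auto simp: bij_betw_def elim!: inj_on_subset)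

lemma card_coset_union: "0 < q \<Longrightarrow> T \<subseteq> ZNd q d \<Longrightarrow> card (coset_union d q r T) = card T * r ^ d"
  by (simp add: coset_union_def card_image inj_on_mix card_cartesian_product)

text \<open>The character factorises over the two digits, and the high digit runs over a complete
  system modulo \<open>r\<close>, whose character sum vanishes unless \<open>r\<close> divides the
  frequency.\<close>

lemma sum_chi_coset_union:
  assumes "0 < q" "0 < r" "T \<subseteq> ZNd q d"
  shows "(\<Sum>x\<in>coset_union d q r T. chi (q * r) d x \<xi>)
       = (if \<forall>i<d. r dvd \<xi> i then of_nat r ^ d * (\<Sum>t\<in>T. chi (q * r) d t \<xi>) else 0)"
proof -
  have if_mult: "x * (if P then y else 0) = (if P then y * x else 0)" for x y :: complex and P
    by simp
  have "(\<Sum>x\<in>coset_union d q r T. chi (q * r) d x \<xi>)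
      = (\<Sum>(t, h)\<in>T \<times> ZNd r d. chi (q * r) d t \<xi> * chi r d h \<xi>)"
    unfolding coset_union_def using assms
    by (subst sum.reindex) (auto simp: inj_on_mix chi_mix intro!: sum.cong)
  also have "\<dots> = (\<Sum>t\<in>T. chi (q * r) d t \<xi>) * (\<Sum>h\<in>ZNd r d. chi r d h \<xi>)"
    by (simp add: sum_product sum.cartesian_product)
  also have "\<dots> = (if \<forall>i<d. r dvd \<xi> i then of_nat r ^ d * (\<Sum>t\<in>T. chi (q * r) d t \<xi>) else 0)"
    unfolding sum_chi[OF assms(2)] by (rule if_mult)
  finally show ?thesis .
qed

text \<open>The transform of \<open>coset_union d q r T\<close> is supported on the frequencies divisible by \<open>r\<close>,
  and there it is a multiple of the transform of \<open>T\<close>.\<close>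
lemma sum_coset_union_frequencies:
  fixes \<Phi> :: "complex \<Rightarrow> real"
  assumes "0 < q" "0 < r" "T \<subseteq> ZNd q d" "\<Phi> 0 = 0"
  shows "(\<Sum>\<xi>\<in>ZNd (q * r) d. \<Phi> (\<Sum>x\<in>coset_union d q r T. chi (q * r) d x \<xi>))
       = (\<Sum>\<eta>\<in>ZNd q d. \<Phi> (of_nat r ^ d * (\<Sum>t\<in>T. chi q d t \<eta>)))"
proof -
  let ?A = "{\<xi>\<in>ZNd (q * r) d. \<forall>i<d. r dvd \<xi> i}"
  let ?V = "\<lambda>\<xi>. \<Sum>x\<in>coset_union d q r T. chi (q * r) d x \<xi>"
  let ?m = "\<lambda>\<eta>. \<lambda>i\<in>{..<d}. r * \<eta> i"
  have "(\<Sum>\<xi>\<in>ZNd (q * r) d. \<Phi> (?V \<xi>)) = (\<Sum>\<xi>\<in>?A. \<Phi> (?V \<xi>))"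
    using assms by (intro sum.mono_neutral_right) (auto simp: sum_chi_coset_union)
  also have "\<dots> = (\<Sum>\<eta>\<in>ZNd q d. \<Phi> (?V (?m \<eta>)))"
  proof (rule sum.reindex_bij_betw[symmetric])
    show "bij_betw ?m (ZNd q d) ?A"
    proof (rule bij_betw_byWitness[where f' = "\<lambda>\<xi>. \<lambda>i\<in>{..<d}. \<xi> i div r"])
      show "\<forall>\<eta>\<in>ZNd q d. (\<lambda>i\<in>{..<d}. ?m \<eta> i div r) = \<eta>"
        using assms by (auto simp: ZNd_less intro!: ZNd_eqI[of _ q])
      show "\<forall>\<xi>\<in>?A. ?m (\<lambda>i\<in>{..<d}. \<xi> i div r) = \<xi>"
        by (auto simp: ZNd_less intro!: ZNd_eqI[of _ "q * r"])
      show "?m ` ZNd q d \<subseteq> ?A" using assms by (auto simp: ZNd_less)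
      show "(\<lambda>\<xi>. \<lambda>i\<in>{..<d}. \<xi> i div r) ` ?A \<subseteq> ZNd q d"
        by (auto simp: ZNd_less less_mult_imp_div_less mult.commute)
    qed
  qed
  also have "\<dots> = (\<Sum>\<eta>\<in>ZNd q d. \<Phi> (of_nat r ^ d * (\<Sum>t\<in>T. chi q d t \<eta>)))"
  proof (intro sum.cong refl)
    fix \<eta>
    have "dot d t (?m \<eta>) = r * dot d t \<eta>" for t
      by (simp add: dot_def sum_distrib_left mult_ac)
    then have *: "chi (q * r) d t (?m \<eta>) = chi q d t \<eta>" for t
      using assms by (simp add: chi_def field_simps)
    have "?V (?m \<eta>) = of_nat r ^ d * (\<Sum>t\<in>T. chi q d t \<eta>)"
      by (subst sum_chi_coset_union[OF assms(1-3)]) (simp add: *)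
    then show "\<Phi> (?V (?m \<eta>)) = \<Phi> (of_nat r ^ d * (\<Sum>t\<in>T. chi q d t \<eta>))" by simp
  qed
  finally show ?thesis .
qed

section \<open>Random sets with small moments\<close>

text \<open>Choosing one point in each residue class modulo \<open>s\<close>, instead of a Bernoulli subset, gives
  the cardinality exactly and makes the mean of every nontrivial coefficient vanish.\<close>
lemma exists_small_moment_set:
  fixes p :: real
  assumes s: "0 < s" and m: "0 < m" and p: "0 < p"
  shows "\<exists>T. T \<subseteq> ZNd (s * m) d \<and> card T = s ^ d \<and>
    (\<Sum>\<eta>\<in>ZNd (s * m) d. norm (\<Sum>t\<in>T. chi (s * m) d t \<eta>) powr p)
      \<le> real (s ^ d) powr p
         + 4 * exp 1 * (4 * p) powr p * real ((s * m) ^ d) * real (s ^ d) powr (p / 2)"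
proof -
  define J where "J = ZNd s d"
  define B where "B = ZNd m d"
  define Q where "Q = s * m"
  define C where "C = 4 * exp 1 * (4 * p) powr p * real (s ^ d) powr (p / 2)"
  define G where "G = J \<rightarrow>\<^sub>E B"
  have Q: "Q > 0" using s m by (simp add: Q_def)
  have fin: "finite J" "finite B" by (simp_all add: J_def B_def)
  have ne: "J \<noteq> {}" "B \<noteq> {}" using s m fin card_gt_0_iff[of J] card_gt_0_iff[of B]
    by (auto simp: J_def B_def)
  have cJ: "card J = s ^ d" by (simp add: J_def)
  have cG: "real (card G) = real (card B) ^ card J" using fin by (simp add: G_def card_PiE)
  have Gpos: "card G > 0" and finG: "finite G"
    using fin ne by (simp_all add: G_def card_PiE finite_PiE card_gt_0_iff)
  define X where "X g \<eta> = (\<Sum>j\<in>J. chi Q d (mix d s j (g j)) \<eta>)" for g \<eta>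
  define Z where "Z = (\<lambda>i\<in>{..<d}. 0 :: nat)"
  have Z: "Z \<in> ZNd Q d" using Q by (simp add: Z_def)
  have avg: "(\<Sum>g\<in>G. norm (X g \<eta>) powr p) \<le> C * card G" if \<eta>: "\<eta> \<in> ZNd Q d - {Z}" for \<eta>
  proof -
    \<comment> \<open>Summed over all classes \<open>j\<close> and all choices \<open>b\<close>, the
      points exhaust the whole group, so a nonzero frequency has total sum zero.\<close>
    have mean: "(\<Sum>j\<in>J. \<Sum>b\<in>B. chi Q d (mix d s j b) \<eta>) = 0"
    proof -
      have "(\<Sum>j\<in>J. \<Sum>b\<in>B. chi Q d (mix d s j b) \<eta>)
          = (\<Sum>a\<in>J \<times> B. chi Q d ((\<lambda>(t, h). mix d s t h) a) \<eta>)"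
        by (simp add: sum.cartesian_product case_prod_unfold)
      also have "\<dots> = (\<Sum>x\<in>ZNd Q d. chi Q d x \<eta>)"
        unfolding J_def B_def Q_def by (rule sum.reindex_bij_betw[OF bij_betw_mix[OF s]])
      also have "\<dots> = 0"
      proof -
        have "\<not> (\<forall>i<d. Q dvd \<eta> i)"
        proof
          assume D: "\<forall>i<d. Q dvd \<eta> i"
          have "\<eta> = Z"
          proof (rule ZNd_eqI)
            show "\<eta> \<in> ZNd Q d" "Z \<in> ZNd Q d" using \<eta> Z by auto
            fix i assume i: "i < d"
            have "\<eta> i < Q" using \<eta> i ZNd_less by blast
            then show "\<eta> i = Z i" using D i dvd_imp_le[of Q "\<eta> i"] by (cases "\<eta> i") (auto simp: Z_def)
          qed
          then show False using \<eta> by simp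
        qed
        then show ?thesis by (simp only: sum_chi[OF Q] if_False)
      qed
      finally show ?thesis .
    qed
    show ?thesis
      using sum_norm_powr_selection_le[OF fin(1) ne(1) fin(2) ne(2) p _ mean]
      unfolding X_def C_def cG unfolding G_def[symmetric] cJ by simp
  qed
  have "(\<Sum>g\<in>G. \<Sum>\<eta>\<in>ZNd Q d - {Z}. norm (X g \<eta>) powr p)
      = (\<Sum>\<eta>\<in>ZNd Q d - {Z}. \<Sum>g\<in>G. norm (X g \<eta>) powr p)"
    by (rule sum.swap)
  also have "\<dots> \<le> (\<Sum>\<eta>\<in>ZNd Q d - {Z}. C * card G)" by (intro sum_mono avg)
  also have "\<dots> = real (card (ZNd Q d - {Z})) * (C * card G)" by simp
  also have "\<dots> \<le> real (Q ^ d) * (C * card G)"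
    using card_mono[of "ZNd Q d" "ZNd Q d - {Z}"] by (intro mult_right_mono) (auto simp: C_def)
  also have "\<dots> = (\<Sum>g\<in>G. real (Q ^ d) * C)" by simp
  \<comment> \<open>If every selection exceeded the bound, so would the sum over the nonempty set
    \<open>G\<close>; hence some selection does no worse than the average.\<close>
  finally obtain g where g: "g \<in> G" "(\<Sum>\<eta>\<in>ZNd Q d - {Z}. norm (X g \<eta>) powr p) \<le> real (Q ^ d) * C"
    using sum_strict_mono[OF finG, of "\<lambda>_. real (Q ^ d) * C" "\<lambda>g. \<Sum>\<eta>\<in>ZNd Q d - {Z}. norm (X g \<eta>) powr p"]
      Gpos by (metis card_gt_0_iff not_le)
  define T where "T = (\<lambda>j. mix d s j (g j)) ` J"
  have gB: "g j \<in> B" if "j \<in> J" for j using g(1) that by (auto simp: G_def)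
  \<comment> \<open>Points chosen in different residue classes differ in their low digits, so
    \<open>T\<close> has exactly one point for each class.\<close>
  have inj: "inj_on (\<lambda>j. mix d s j (g j)) J"
  proof (rule inj_onI)
    fix j j' assume jj: "j \<in> J" "j' \<in> J" "mix d s j (g j) = mix d s j' (g j')"
    show "j = j'"
      using inj_onD[OF inj_on_mix[OF s, of J d m], of "(j, g j)" "(j', g j')"] jj gB
      by (auto simp: J_def B_def)
  qed
  have XT: "(\<Sum>t\<in>T. chi Q d t \<eta>) = X g \<eta>" for \<eta>
    by (simp add: T_def X_def sum.reindex inj)
  have "T \<subseteq> ZNd Q d"
    using bij_betw_mix[OF s, of d m] gB by (fastforce simp: T_def J_def B_def Q_def bij_betw_def)
  moreover have "card T = s ^ d" by (simp add: T_def card_image inj cJ)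
  moreover have "(\<Sum>\<eta>\<in>ZNd Q d. norm (\<Sum>t\<in>T. chi Q d t \<eta>) powr p)
      \<le> real (s ^ d) powr p + real (Q ^ d) * C"
  proof -
    \<comment> \<open>The zero frequency, excluded from the averaging, is bounded trivially and
      contributes the first term.\<close>
    have "norm (X g Z) \<le> real (s ^ d)"
      using norm_sum[of "\<lambda>j. chi Q d (mix d s j (g j)) Z" J] by (simp add: X_def cJ)
    then have "norm (X g Z) powr p \<le> real (s ^ d) powr p" using p by (intro powr_mono2) auto
    then show ?thesis using g(2) Z by (simp add: XT sum.remove[of "ZNd Q d" Z])
  qed
  ultimately show ?thesis by (intro exI[of _ T]) (simp add: Q_def C_def mult_ac)
qed

section \<open>Lower bound for the 1-norm\<close>

text \<open>Pointwise form of Hoelder interpolation of the 2-norm between the 1-norm and the p-norm.\<close>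
lemma square_le_interpolation:
  fixes t \<tau> p :: real
  assumes "0 \<le> t" "0 < \<tau>" "2 \<le> p"
  shows "t\<^sup>2 \<le> \<tau> * t + \<tau> powr (2 - p) * t powr p"
proof (cases "t \<le> \<tau>")
  case True
  then have "t * t \<le> \<tau> * t" using assms by (intro mult_right_mono)
  then show ?thesis by (simp add: power2_eq_square add_increasing2)
next
  case False
  then have t: "0 < t" using assms by simp
  have "1 \<le> (t / \<tau>) powr (p - 2)" using False assms by (intro ge_one_powr_ge_zero) auto
  then have "t\<^sup>2 \<le> t\<^sup>2 * (t / \<tau>) powr (p - 2)" by (simp add: mult_le_cancel_left1)
  also have "\<dots> = \<tau> powr (2 - p) * t powr p"
    using t assms by (simp add: powr_divide powr_diff field_simps power2_eq_square)
  finally show ?thesis using assms by (simp add: add_increasing)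
qed

text \<open>Apply the pointwise interpolation with a threshold \<open>\<tau>\<close> proportional to
  sqrt n. The \<open>p\<close>-th moment term then accounts for at most half of the square sum, and
  the 1-norm must supply the rest.\<close>

lemma l1_lower_bound:
  fixes x :: "'a \<Rightarrow> real" and p n M K :: real
  assumes x: "\<And>a. a \<in> A \<Longrightarrow> 0 \<le> x a" and pos: "2 < p" "0 < n" "0 < K"
    and l2: "(\<Sum>a\<in>A. (x a)\<^sup>2) = M * n"
    and lp: "(\<Sum>a\<in>A. x a powr p) \<le> K * M * n powr (p / 2)"
  shows "M * sqrt n \<le> 2 * (2 * K) powr (1 / (p - 2)) * (\<Sum>a\<in>A. x a)"
proof -
  \<comment> \<open>Solves \<open>L powr (2 - p) * (2 * K) = 1\<close>, which makes the
    \<open>p\<close>-th moment term exactly M n / 2.\<close>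
  define L where "L = (2 * K) powr (1 / (p - 2))"
  define \<tau> where "\<tau> = L * sqrt n"
  have L: "0 < L" using pos by (simp add: L_def)
  have "1 / (p - 2) * (2 - p) = - 1" using pos by (simp add: field_simps)
  then have "L powr (2 - p) = (2 * K) powr (- 1)" by (simp only: L_def powr_powr)
  then have L': "L powr (2 - p) * (2 * K) = 1" using pos by (simp add: powr_minus field_simps)
  have "sqrt n powr (2 - p) * n powr (p / 2) = n"
  proof -
    have "sqrt n powr (2 - p) * n powr (p / 2) = n powr ((2 - p) / 2 + p / 2)"
      using pos by (simp add: powr_powr powr_add flip: powr_half_sqrt)
    also have "(2 - p) / 2 + p / 2 = 1" by (simp add: field_simps)
    finally show ?thesis using pos by simp
  qed
  then have \<tau>: "\<tau> powr (2 - p) * (K * M * n powr (p / 2)) = M * n / 2"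
    using L' L pos by (simp add: \<tau>_def powr_mult field_simps)
  have "M * n \<le> (\<Sum>a\<in>A. \<tau> * x a + \<tau> powr (2 - p) * x a powr p)"
    unfolding l2[symmetric] using x pos L
    by (intro sum_mono square_le_interpolation) (auto simp: \<tau>_def)
  also have "\<dots> = \<tau> * (\<Sum>a\<in>A. x a) + \<tau> powr (2 - p) * (\<Sum>a\<in>A. x a powr p)"
    by (simp add: sum.distrib sum_distrib_left)
  also have "\<dots> \<le> \<tau> * (\<Sum>a\<in>A. x a) + \<tau> powr (2 - p) * (K * M * n powr (p / 2))"
    using lp by (intro add_left_mono mult_left_mono) auto
  finally have "M * n \<le> 2 * \<tau> * (\<Sum>a\<in>A. x a)" unfolding \<tau> by simp
  then have "sqrt n * (M * sqrt n) \<le> sqrt n * (2 * L * (\<Sum>a\<in>A. x a))"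
    using pos by (simp add: \<tau>_def mult_ac real_sqrt_mult_self)
  then show ?thesis using pos by (simp add: L_def)
qed

section \<open>Norms of normalised indicators\<close>

lemma fourier_scaled_indicator:
  assumes "S \<subseteq> ZNd N d"
  shows "fourier N d (\<lambda>x. a * indicator S x) \<xi>
       = of_real (real N powr (- (real d / 2))) * a * (\<Sum>x\<in>S. chi N d x \<xi>)"
proof -
  have "(\<Sum>x\<in>ZNd N d. a * indicator S x * chi N d x \<xi>) = (\<Sum>x\<in>S. a * chi N d x \<xi>)"
    using assms by (intro sum.mono_neutral_cong_right) (auto simp: indicator_def)
  then show ?thesis by (simp add: fourier_eq_chi sum_distrib_left mult.assoc)
qed

text \<open>The unitary factor is common to both norms and cancels in the ratio.\<close>

lemma FR_indicator:
  assumes "0 < N" "S \<subseteq> ZNd N d"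
  shows "FR N d (indicator S) = (\<Sum>\<xi>\<in>ZNd N d. norm (\<Sum>x\<in>S. chi N d x \<xi>))
           / sqrt (\<Sum>\<xi>\<in>ZNd N d. (norm (\<Sum>x\<in>S. chi N d x \<xi>))\<^sup>2)"
proof -
  define u where "u = real N powr (- (real d / 2))"
  have u: "u > 0" using assms by (simp add: u_def)
  have "norm (fourier N d (indicator S) \<xi>) = u * norm (\<Sum>x\<in>S. chi N d x \<xi>)" for \<xi>
    using fourier_scaled_indicator[OF assms(2), of 1 \<xi>] u by (simp add: norm_mult flip: u_def)
  then show ?thesis
    using u by (simp add: FR_def Lnorm_def powr_half_sqrt sum_nonneg power_mult_distrib
        real_sqrt_mult flip: sum_distrib_left)
qed

lemma Lnorm_inf_eqI:
  assumes "\<And>x. x \<in> ZNd N d \<Longrightarrow> norm (f x) \<le> c" "z \<in> ZNd N d" "norm (f z) = c"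
  shows "Lnorm_inf N d f = c"
  unfolding Lnorm_inf_def using assms by (intro Max_eqI) (auto intro: rev_image_eqI)

text \<open>This scaling removes the unitary factor and, for nonempty \<open>S\<close>, makes the
  value at frequency zero equal to 1, the largest possible modulus.\<close>

lemma normalised_fourier:
  assumes "0 < N" "S \<subseteq> ZNd N d"
  shows "fourier N d (\<lambda>x. of_real (real N powr (real d / 2) / real (card S)) * indicator S x) \<xi>
       = (\<Sum>x\<in>S. chi N d x \<xi>) / of_nat (card S)"
  unfolding fourier_scaled_indicator[OF assms(2)] powr_minus of_real_divide of_real_inverse
  using assms(1) by simp

text \<open>The construction at one scale. The two comparisons of \<open>M\<close> with n^(p/2) do
  separate work: \<open>nD\<close> absorbs the peak into the bulk for the lower bound on
  \<open>FR\<close>, and \<open>MD\<close> bounds the bulk by the peak for the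
  \<open>p\<close>-norm.\<close>

lemma exists_coset_union:
  fixes s m r d :: nat and p D :: real
  defines "N \<equiv> s * m * r" and "n \<equiv> real (s ^ d)" and "M \<equiv> real ((s * m) ^ d)"
    and "C \<equiv> 4 * exp 1 * (4 * p) powr p"
  assumes pos: "0 < s" "0 < m" "0 < r" and p: "2 < p" and D: "0 < D"
    and MD: "M \<le> D * n powr (p / 2)" and nD: "n powr (p / 2) \<le> D * M"
  shows "\<exists>S\<subseteq>ZNd N d. card S = s ^ d * r ^ d \<and>
    FR N d (indicator S) \<le> sqrt M \<and>
    sqrt M \<le> 2 * (2 * (D + C)) powr (1 / (p - 2)) * FR N d (indicator S) \<and>
    Lnorm_inf N d (fourier N d (\<lambda>x. of_real (real N powr (real d / 2) / real (card S)) * indicator S x)) = 1 \<and>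
    Lnorm N d p (fourier N d (\<lambda>x. of_real (real N powr (real d / 2) / real (card S)) * indicator S x))
      \<le> (1 + C * D) powr (1 / p)"
proof -
  define Q where "Q = s * m"
  have Q: "0 < Q" and N: "0 < N" using pos by (simp_all add: Q_def N_def)
  have n: "0 < n" and M: "0 < M" and C: "0 < C" using pos p by (simp_all add: n_def M_def C_def)
  obtain T where T: "T \<subseteq> ZNd Q d" "card T = s ^ d" and
    TP: "(\<Sum>\<eta>\<in>ZNd Q d. norm (\<Sum>t\<in>T. chi Q d t \<eta>) powr p) \<le> n powr p + C * M * n powr (p / 2)"
    using exists_small_moment_set[OF pos(1,2), of p d] p
    unfolding Q_def n_def M_def C_def by auto
  define X where "X \<eta> = norm (\<Sum>t\<in>T. chi Q d t \<eta>)" for \<eta>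
  define S where "S = coset_union d Q r T"
  define V where "V \<xi> = (\<Sum>x\<in>S. chi N d x \<xi>)" for \<xi>
  define w where "w = real (r ^ d)"
  have w: "0 < w" using pos by (simp add: w_def)
  have S: "S \<subseteq> ZNd N d" using coset_union_subset[OF Q T(1)] by (simp add: S_def N_def Q_def)
  have cS: "card S = s ^ d * r ^ d" using card_coset_union[OF Q T(1)] T(2) by (simp add: S_def)
  have cS': "real (card S) = n * w" by (simp add: cS n_def w_def)
  have XP: "(\<Sum>\<eta>\<in>ZNd Q d. X \<eta> powr p) \<le> n powr p + C * M * n powr (p / 2)"
    using TP by (simp add: X_def)
  have X2: "(\<Sum>\<eta>\<in>ZNd Q d. (X \<eta>)\<^sup>2) = M * n"
    using plancherel[OF Q T(1)] T(2) by (simp add: X_def M_def n_def Q_def)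
  \<comment> \<open>Every sum over frequencies modulo \<open>N\<close> becomes one modulo
    \<open>Q\<close>; the condition at 0 discards the frequencies where the transform
    vanishes.\<close>
  have V: "(\<Sum>\<xi>\<in>ZNd N d. \<phi> (norm (V \<xi>))) = (\<Sum>\<eta>\<in>ZNd Q d. \<phi> (w * X \<eta>))"
    if "\<phi> 0 = 0" for \<phi> :: "real \<Rightarrow> real"
    using sum_coset_union_frequencies[OF Q pos(3) T(1), of "\<lambda>z. \<phi> (norm z)"] that
    by (simp add: V_def S_def X_def w_def N_def Q_def norm_mult norm_power)
  have FR: "FR N d (indicator S) = (\<Sum>\<eta>\<in>ZNd Q d. X \<eta>) / sqrt (M * n)"
    using V[of "\<lambda>t. t"] V[of "\<lambda>t. t\<^sup>2"] w
    by (simp add: FR_indicator[OF N S] flip: V_def sum_distrib_left X2)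
       (simp add: power_mult_distrib real_sqrt_mult flip: sum_distrib_left)
  \<comment> \<open>Cauchy-Schwarz over the \<open>M\<close> frequencies modulo
    \<open>Q\<close>.\<close>
  have "((\<Sum>\<eta>\<in>ZNd Q d. X \<eta>))\<^sup>2 \<le> M * (M * n)"
    using Cauchy_Schwarz_ineq_sum[of "\<lambda>_. 1" X "ZNd Q d"] unfolding X2 by (simp add: M_def Q_def)
  then have "(\<Sum>\<eta>\<in>ZNd Q d. X \<eta>) \<le> sqrt M * sqrt (M * n)"
    using real_le_rsqrt by (simp flip: real_sqrt_mult)
  then have upper: "FR N d (indicator S) \<le> sqrt M"
    using M n by (simp add: FR field_simps)
  have nn: "n powr p = n powr (p / 2) * n powr (p / 2)" by (simp flip: powr_add)
  also have "\<dots> \<le> D * M * n powr (p / 2)" using nD by (intro mult_right_mono) auto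
  finally have "(\<Sum>\<eta>\<in>ZNd Q d. X \<eta> powr p) \<le> (D + C) * M * n powr (p / 2)"
    using XP by (simp add: algebra_simps)
  then have "M * sqrt n \<le> 2 * (2 * (D + C)) powr (1 / (p - 2)) * (\<Sum>\<eta>\<in>ZNd Q d. X \<eta>)"
    using X2 n p D C by (intro l1_lower_bound) (auto simp: X_def)
  moreover have "sqrt (M * n) * sqrt M = (sqrt M * sqrt M) * sqrt n" by (simp add: real_sqrt_mult)
  then have "sqrt (M * n) * sqrt M = M * sqrt n" using M by simp
  ultimately have lower: "sqrt M \<le> 2 * (2 * (D + C)) powr (1 / (p - 2)) * FR N d (indicator S)"
    using M n by (simp add: FR field_simps)
  let ?f = "\<lambda>x. of_real (real N powr (real d / 2) / real (card S)) * indicator S x :: complex"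
  define F where "F = fourier N d ?f"
  have f: "norm (F \<xi>) = norm (V \<xi>) / (n * w)" for \<xi>
    unfolding F_def normalised_fourier[OF N S] by (simp add: norm_divide cS' V_def)
  have inf: "Lnorm_inf N d (F) = 1"
  proof (rule Lnorm_inf_eqI)
    show "norm (F \<xi>) \<le> 1" for \<xi>
      using norm_sum[of "\<lambda>x. chi N d x \<xi>" S] n w by (simp add: f V_def cS' field_simps)
    show "(\<lambda>i\<in>{..<d}. 0) \<in> ZNd N d" using N by simp
    have "V (\<lambda>i\<in>{..<d}. 0) = of_nat (card S)" by (simp add: V_def chi_def dot_def)
    then show "norm (F (\<lambda>i\<in>{..<d}. 0)) = 1" using n w cS' by (simp add: f)
  qed
  have "(\<Sum>\<xi>\<in>ZNd N d. norm (F \<xi>) powr p)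
      = (\<Sum>\<eta>\<in>ZNd Q d. (w * X \<eta> / (n * w)) powr p)"
    using V[of "\<lambda>t. (t / (n * w)) powr p"] by (simp add: f)
  also have "\<dots> = (\<Sum>\<eta>\<in>ZNd Q d. X \<eta> powr p) / n powr p"
    using w n by (simp add: powr_divide X_def sum_divide_distrib)
  also have "\<dots> \<le> (n powr p + C * M * n powr (p / 2)) / n powr p"
    using XP by (intro divide_right_mono) auto
  also have "\<dots> \<le> (n powr p + C * (D * n powr (p / 2)) * n powr (p / 2)) / n powr p"
    using MD C by (intro divide_right_mono add_left_mono mult_right_mono mult_left_mono) auto
  also have "\<dots> = 1 + C * D"
    using n by (simp add: add_divide_distrib nn)
  finally have "Lnorm N d p (F) \<le> (1 + C * D) powr (1 / p)"
    unfolding Lnorm_def using p by (intro powr_mono2) (auto intro!: sum_nonneg)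
  then show ?thesis using S cS upper lower inf unfolding F_def by blast
qed

section \<open>Choice of the scales and the main result\<close>

text \<open>All moduli are powers of \<open>l\<close>, so the ideal real exponents are rounded down.
  Rounding changes each quantity by a bounded power of \<open>l\<close>, independent of
  \<open>k\<close>, which goes into the constants.\<close>

lemma exists_set_at_scale:
  fixes d l k :: nat and \<alpha> \<kappa> :: real
  defines "p \<equiv> crit_exp d \<alpha> \<kappa>" and "N \<equiv> l ^ k"
  defines "C \<equiv> 4 * exp 1 * (4 * p) powr p" and "D \<equiv> real l powr (d * (p / 2 + 1))"
  assumes l: "2 \<le> l" and \<kappa>: "0 \<le> \<kappa>" "\<kappa> < \<alpha> / 2" and \<alpha>: "\<alpha> < real d"
  shows "\<exists>S\<subseteq>ZNd N d.
    real (card S) \<le> real N powr \<alpha> \<and> real N powr \<alpha> \<le> real l powr d * real (card S) \<and>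
    FR N d (indicator S) \<le> real l powr (d / 2) * real N powr (real d / 2 - \<kappa>) \<and>
    real N powr (real d / 2 - \<kappa>) \<le> 2 * (2 * (D + C)) powr (1 / (p - 2)) * FR N d (indicator S) \<and>
    Lnorm_inf N d (fourier N d (\<lambda>x. of_real (real N powr (real d / 2) / real (card S)) * indicator S x)) = 1 \<and>
    Lnorm N d p (fourier N d (\<lambda>x. of_real (real N powr (real d / 2) / real (card S)) * indicator S x))
      \<le> (1 + C * D) powr (1 / p)"
proof -
  define \<beta> where "\<beta> = 2 * \<kappa> / d"
  define \<gamma> where "\<gamma> = \<alpha> / d"
  define b where "b = nat \<lfloor>\<beta> * k\<rfloor>"
  define c where "c = nat \<lfloor>\<gamma> * k\<rfloor>"
  have d: "0 < real d" using \<kappa> \<alpha> by linarith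
  have bc: "0 \<le> \<beta>" "\<beta> < \<gamma>" "\<gamma> < 1"
    using d \<kappa> \<alpha> by (simp_all add: \<beta>_def \<gamma>_def divide_strict_right_mono)
  have b: "real b \<le> \<beta> * k" "\<beta> * k \<le> real b + 1"
    unfolding b_def using bc of_nat_floor[of "\<beta> * k"] by (simp, linarith)
  have c: "real c \<le> \<gamma> * k" "\<gamma> * k \<le> real c + 1"
    unfolding c_def using bc of_nat_floor[of "\<gamma> * k"] by (simp, linarith)
  have "b \<le> c" unfolding b_def c_def using bc by (intro nat_mono floor_mono mult_right_mono) auto
  have "\<gamma> * k \<le> 1 * real k" using bc by (intro mult_right_mono) auto
  then have "c \<le> k" using c by linarith
  \<comment> \<open>This identity characterises the critical exponent: up to rounding, n^(p/2) and
    \<open>M\<close> are the same power of N.\<close>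
  have p: "(\<gamma> - \<beta>) * (p / 2) = 1 - \<beta>" "2 < p"
    using d \<kappa> \<alpha> by (simp_all add: p_def crit_exp_def \<beta>_def \<gamma>_def field_simps)
  \<comment> \<open>Here \<open>s * m\<close> is the modulus of \<open>T\<close> and
    \<open>s ^ d\<close> its cardinality, while \<open>r\<close> is the index of the reduction in
    each coordinate.\<close>
  define s m r where "s = l ^ (c - b)" and "m = l ^ (k - c)" and "r = l ^ b"
  have sm: "s * m = l ^ (k - b)" and smr: "s * m * r = N" and sr: "s ^ d * r ^ d = l ^ (c * d)"
    using \<open>b \<le> c\<close> \<open>c \<le> k\<close>
    by (simp_all add: s_def m_def r_def N_def flip: power_add power_mult distrib_right)
  have pw: "real (l ^ i) = real l powr real i" for i using l by (simp add: powr_realpow)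
  have n: "real (s ^ d) = real l powr ((real c - real b) * d)"
    using \<open>b \<le> c\<close> pw[of "(c - b) * d"] by (simp add: s_def power_mult of_nat_diff)
  have M: "real ((s * m) ^ d) = real l powr ((real k - real b) * d)"
    using \<open>b \<le> c\<close> \<open>c \<le> k\<close> pw[of "(k - b) * d"] by (simp add: sm power_mult of_nat_diff)
  have N: "real N = real l powr k" by (simp add: N_def pw flip: of_nat_power)
  have P: "(\<gamma> - \<beta>) * k * (p / 2) = (1 - \<beta>) * k" by (simp add: p(1)[symmetric])
  \<comment> \<open>The difference \<open>c - b\<close> is within 1 of its ideal value, costing p/2,
    and \<open>b\<close> is within 1 of its own; together they give the exponent p/2 + 1 per
    dimension in \<open>D\<close>.\<close>
  have "(real c - real b) * (p / 2) \<le> ((\<gamma> - \<beta>) * k + 1) * (p / 2)"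
    using b c p by (intro mult_right_mono) (auto simp: algebra_simps)
  then have up: "(real c - real b) * (p / 2) \<le> (p / 2 + 1) + (real k - real b)"
    unfolding distrib_right P using b by (simp add: algebra_simps)
  have "((\<gamma> - \<beta>) * k - 1) * (p / 2) \<le> (real c - real b) * (p / 2)"
    using b c p by (intro mult_right_mono) (auto simp: algebra_simps)
  then have lo: "real k - real b \<le> (p / 2 + 1) + (real c - real b) * (p / 2)"
    unfolding left_diff_distrib[of _ _ "p / 2"] P using b by (simp add: algebra_simps)
  have nM: "real (s ^ d) powr (p / 2) \<le> D * real ((s * m) ^ d)"
  proof -
    have "d * ((real c - real b) * (p / 2)) \<le> d * ((p / 2 + 1) + (real k - real b))"
      using up by (intro mult_left_mono) auto
    then show ?thesis using l unfolding n M D_def powr_powr powr_add[symmetric]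
      by (intro powr_mono) (simp_all add: field_simps)
  qed
  have Mn: "real ((s * m) ^ d) \<le> D * real (s ^ d) powr (p / 2)"
  proof -
    have "d * (real k - real b) \<le> d * ((p / 2 + 1) + (real c - real b) * (p / 2))"
      using lo by (intro mult_left_mono) auto
    then show ?thesis using l unfolding n M D_def powr_powr powr_add[symmetric]
      by (intro powr_mono) (simp_all add: field_simps)
  qed
  have card1: "real (s ^ d * r ^ d) \<le> real N powr \<alpha>"
   and card2: "real N powr \<alpha> \<le> real l powr d * real (s ^ d * r ^ d)"
  proof -
    have \<alpha>d: "\<alpha> = \<gamma> * d" using d by (simp add: \<gamma>_def)
    have "real c * d \<le> \<gamma> * k * d" "\<gamma> * k * d \<le> (real c + 1) * d"
      using c by (intro mult_right_mono; simp)+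
    then show "real (s ^ d * r ^ d) \<le> real N powr \<alpha>"
        "real N powr \<alpha> \<le> real l powr d * real (s ^ d * r ^ d)"
      unfolding sr pw N \<alpha>d using l by (simp_all add: powr_powr algebra_simps flip: powr_add)
  qed
  have root: "sqrt (real ((s * m) ^ d)) = real l powr ((real k - real b) * (d / 2))"
    unfolding M by (simp add: powr_powr flip: powr_half_sqrt)
  have \<kappa>d: "real k * (real d / 2 - \<kappa>) = (k - \<beta> * k) * (d / 2)"
    using d by (simp add: \<beta>_def field_simps)
  have "(k - \<beta> * k) * (d / 2) \<le> (real k - real b) * (d / 2)"
    and "(real k - real b) * (d / 2) \<le> (1 + (k - \<beta> * k)) * (d / 2)"
    using b by (intro mult_right_mono; simp)+
  then have "(k - \<beta> * k) * (d / 2) \<le> (real k - real b) * (d / 2)"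
    and "(real k - real b) * (d / 2) \<le> d / 2 + (k - \<beta> * k) * (d / 2)"
    by (simp_all only: distrib_right mult_1)
  then have M1: "real N powr (real d / 2 - \<kappa>) \<le> sqrt (real ((s * m) ^ d))"
    and M2: "sqrt (real ((s * m) ^ d)) \<le> real l powr (d / 2) * real N powr (real d / 2 - \<kappa>)"
    unfolding root N powr_powr \<kappa>d powr_add[symmetric] using l by (intro powr_mono; simp)+
  have pos: "0 < s" "0 < m" "0 < r" "0 < D" using l by (simp_all add: s_def m_def r_def D_def)
  obtain S where "S \<subseteq> ZNd N d" and card: "card S = s ^ d * r ^ d" and
    "FR N d (indicator S) \<le> sqrt (real ((s * m) ^ d))"
    "sqrt (real ((s * m) ^ d)) \<le> 2 * (2 * (D + C)) powr (1 / (p - 2)) * FR N d (indicator S)"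
    "Lnorm_inf N d (fourier N d (\<lambda>x. of_real (real N powr (real d / 2) / real (card S)) * indicator S x)) = 1"
    "Lnorm N d p (fourier N d (\<lambda>x. of_real (real N powr (real d / 2) / real (card S)) * indicator S x))
      \<le> (1 + C * D) powr (1 / p)"
    using exists_coset_union[OF pos(1-3) p(2) pos(4) Mn nM] unfolding smr C_def by blast
  then show ?thesis using card1 card2 M1 M2 unfolding card[symmetric]
    by (intro exI[of _ S]) (auto intro: order_trans)
qed

theorem theorem7p2:
  fixes d l :: nat and \<alpha> \<kappa> :: real
  assumes "1 \<le> d" and "prime l" and "odd l"
    and "0 < \<alpha>" and "\<alpha> < real d"
    and "0 \<le> \<kappa>" and "\<kappa> < \<alpha> / 2"
  shows "\<exists>(S :: nat \<Rightarrow> (nat \<Rightarrow> nat) set) (f :: nat \<Rightarrow> (nat \<Rightarrow> nat) \<Rightarrow> complex).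
    (\<forall>N\<in>{l ^ k | k. 1 \<le> k}. S N \<subseteq> ZNd N d) \<and>
    comparable_on {l ^ k | k. 1 \<le> k} (\<lambda>N. real (card (S N))) (\<lambda>N. real N powr \<alpha>) \<and>
    comparable_on {l ^ k | k. 1 \<le> k}
      (\<lambda>N. FR N d (indicator (S N))) (\<lambda>N. real N powr (real d / 2 - \<kappa>)) \<and>
    (\<forall>N\<in>{l ^ k | k. 1 \<le> k}. \<exists>a :: complex. \<forall>x\<in>ZNd N d. f N x = a * indicator (S N) x) \<and>
    (\<forall>N\<in>{l ^ k | k. 1 \<le> k}. Lnorm_inf N d (fourier N d (f N)) = 1) \<and>
    bdd_above ((\<lambda>N. Lnorm N d (crit_exp d \<alpha> \<kappa>) (fourier N d (f N))) ` {l ^ k | k. 1 \<le> k}) \<and>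
    \<not> (bdd_above ((\<lambda>N. Lnorm N d (crit_exp d \<alpha> \<kappa>) (fourier N d (f N))) ` {l ^ k | k. 1 \<le> k}) \<longrightarrow>
        (\<lambda>k. Lnorm_inf (l ^ k) d (fourier (l ^ k) d (f (l ^ k)))) \<longlonglongrightarrow> 0)"
proof -
  let ?K = "{l ^ k | k. 1 \<le> k}"
  let ?f = "\<lambda>N S x. of_real (real N powr (real d / 2) / real (card S)) * indicator S x :: complex"
  define p where "p = crit_exp d \<alpha> \<kappa>"
  define C where "C = 4 * exp 1 * (4 * p) powr p"
  define D where "D = real l powr (d * (p / 2 + 1))"
  define E where "E = 2 * (2 * (D + C)) powr (1 / (p - 2))"
  have l: "2 \<le> l" using assms prime_ge_2_nat by blast
  have "0 < p" using assms by (simp add: p_def crit_exp_def)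
  then have "0 < D + C" using l by (simp add: D_def C_def add_pos_pos)
  then have E: "0 < E" by (simp add: E_def)
  have L: "0 < real l powr x" for x using l by simp
  \<comment> \<open>None of the constants depends on N, so sets chosen separately for each N still
    satisfy uniform bounds.\<close>
  define P where "P N S \<longleftrightarrow> S \<subseteq> ZNd N d \<and>
    real (card S) \<le> real N powr \<alpha> \<and> real N powr \<alpha> \<le> real l powr d * real (card S) \<and>
    FR N d (indicator S) \<le> real l powr (d / 2) * real N powr (real d / 2 - \<kappa>) \<and>
    real N powr (real d / 2 - \<kappa>) \<le> E * FR N d (indicator S) \<and>
    Lnorm_inf N d (fourier N d (?f N S)) = 1 \<and>
    Lnorm N d p (fourier N d (?f N S)) \<le> (1 + C * D) powr (1 / p)" for N S
  have "\<forall>N\<in>?K. \<exists>S. P N S"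
    using exists_set_at_scale[OF l assms(6,7,5)] unfolding P_def p_def C_def D_def E_def by blast
  then obtain S where "\<forall>N\<in>?K. P N (S N)" by (rule bchoice[THEN exE])
  then have S: "S N \<subseteq> ZNd N d"
    and card: "real (card (S N)) \<le> real N powr \<alpha>" "real N powr \<alpha> \<le> real l powr d * real (card (S N))"
    and FR: "FR N d (indicator (S N)) \<le> real l powr (d / 2) * real N powr (real d / 2 - \<kappa>)"
      "real N powr (real d / 2 - \<kappa>) \<le> E * FR N d (indicator (S N))"
    and inf: "Lnorm_inf N d (fourier N d (?f N (S N))) = 1"
    and Lp: "Lnorm N d p (fourier N d (?f N (S N))) \<le> (1 + C * D) powr (1 / p)"
    if "N \<in> ?K" for N
    using that unfolding P_def by blast+
  let ?F = "\<lambda>N. ?f N (S N)"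
  have bdd: "bdd_above ((\<lambda>N. Lnorm N d (crit_exp d \<alpha> \<kappa>) (fourier N d (?F N))) ` ?K)"
    using Lp by (intro bdd_aboveI2[where M = "(1 + C * D) powr (1 / p)"]) (simp add: p_def)
  have "\<not> (\<lambda>k. Lnorm_inf (l ^ k) d (fourier (l ^ k) d (?F (l ^ k)))) \<longlonglongrightarrow> 0"
  proof
    assume "(\<lambda>k. Lnorm_inf (l ^ k) d (fourier (l ^ k) d (?F (l ^ k)))) \<longlonglongrightarrow> 0"
    \<comment> \<open>The norm is known to be 1 only from \<open>k = 1\<close> on, since the sets
      were chosen for positive exponents; hence the eventual form.\<close>
    moreover have "\<forall>\<^sub>F k in sequentially. Lnorm_inf (l ^ k) d (fourier (l ^ k) d (?F (l ^ k))) = 1"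
      using inf by (intro eventually_sequentiallyI[of 1]) blast
    ultimately have "(\<lambda>k :: nat. 1 :: real) \<longlonglongrightarrow> 0"
      by (rule Lim_transform_eventually)
    then show False by (simp add: LIMSEQ_const_iff)
  qed
  moreover have "comparable_on ?K (\<lambda>N. real (card (S N))) (\<lambda>N. real N powr \<alpha>)"
    unfolding comparable_on_def using card L[of d]
    by (intro exI[of _ "1 / real l powr d"] exI[of _ 1]) (auto simp: field_simps)
  moreover have "comparable_on ?K (\<lambda>N. FR N d (indicator (S N))) (\<lambda>N. real N powr (real d / 2 - \<kappa>))"
    unfolding comparable_on_def using FR E L[of "d / 2"]
    by (intro exI[of _ "1 / E"] exI[of _ "real l powr (d / 2)"]) (auto simp: field_simps)
  ultimately show ?thesis
    using S inf bdd by (intro exI[of _ S] exI[of _ ?F]) blast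
qed

end
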